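(* For every strong algebra $(\mathcal{A}, \to_{\mathcal{A}})$ there exist a KN-space $\mathcal{X}$ and an injective map $i: \mathcal{A} \to U(X, \leq, C(X))$ which is a bounded lattice homomorphism and satisfies $i(a \to_{\mathcal{A}} b) = i(a) \to_{\mathcal{X}} i(b)$ for all $a, b \in \mathcal{A}$ (i.e., an embedding of $(\mathcal{A},\to_{\mathcal{A}})$ into the strong algebra $\mathfrak{A}(\mathcal{X})$). Moreover, if $\to_{\mathcal{A}}$ is open, then $\mathcal{X}$ can be taken to be open.
   Context: For a bounded distributive lattice $\mathcal{A}$, an implication over $\mathcal{A}$ is a binary operation $\to$ on $\mathcal{A}$ which is order-reversing in its first argument and order-preserving in its second argument and satisfies $a \to a = 1$ and $(a \to b) \wedge (b \to c) \leq a \to c$; a strong algebra is a pair $(\mathcal{A},\to)$; the implication is open if $a \wedge b \leq c$ implies $a \leq b \to c$. A KN-frame is a tuple $\mathcal{K}=(K,\leq,R,B,N)$ where $(K,\leq)$ is a poset, $R$ a binary relation on $K$, $B \subseteq P(K)$, and $N: K \to P(U(K,\leq,B))$ with $U(K,\leq,B)$ the set of upsets of $(K,\leq)$ belonging to $B$, such that: if $x \leq y$ and $(y,z)\in R$ then $(x,z)\in R$; for all $x$ and upsets $U,V \in B$, $U \subseteq V$ and $U \in N(x)$ imply $V \in N(x)$; $B$ is closed under finite unions (including $K$), complements, and $\lozenge_R(U) = \{x \mid \exists y \in U, (x,y)\in R\}$; and $j(U) = \{x \mid U \in N(x)\} \in B$ for every upset $U \in B$. For $U, V \in U(K,\leq,B)$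 define $U \to_{\mathcal{K}} V = \{x \in K \mid \forall y\in K\,[((x,y)\in R \text{ and } U \in N(y)) \Rightarrow V \in N(y)]\}$; then $\mathfrak{A}(\mathcal{K}) = (U(K,\leq,B), \to_{\mathcal{K}})$ is a strong algebra (lattice operations $\cap,\cup$). The KN-frame is open if for all $x,y \in K$ and upsets $U,V \in B$: $x \in U$, $(x,y)\in R$ and $V \in N(y)$ imply $U \cap V \in N(y)$. A Priestley space is a compact topological space $X$ with a partial order $\leq$ such that whenever $x \not\leq y$ there is a clopen upset containing $x$ but not $y$. A KN-space is a KN-frame $(X,\leq,R,C(X),N)$ where $(X,\leq)$ is a Priestley space and $C(X)$ is the set of clopen subsets of $X$ (so $U(X,\leq,C(X))$ is the set of clopen upsets). *)

theory Defs
  imports "HOL-Analysis.Abstract_Topology"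
begin

definition is_implication ::
    "('a::{distrib_lattice,bounded_lattice} \<Rightarrow> 'a \<Rightarrow> 'a) \<Rightarrow> bool" where
  "is_implication imp \<longleftrightarrow>
     (\<forall>a a' b. a \<le> a' \<longrightarrow> imp a' b \<le> imp a b) \<and>
     (\<forall>a b b'. b \<le> b' \<longrightarrow> imp a b \<le> imp a b') \<and>
     (\<forall>a. imp a a = top) \<and>
     (\<forall>a b c. inf (imp a b) (imp b c) \<le> imp a c)"

definition open_implication ::
    "('a::{distrib_lattice,bounded_lattice} \<Rightarrow> 'a \<Rightarrow> 'a) \<Rightarrow> bool" where
  "open_implication imp \<longleftrightarrow> (\<forall>a b c. inf a b \<le> c \<longrightarrow> a \<le> imp b c)"

definition upsets :: "'x set \<Rightarrow> 'x rel \<Rightarrow> 'x set set \<Rightarrow> 'x set set" where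
  "upsets K le B = {U \<in> B. U \<subseteq> K \<and> (\<forall>x\<in>U. \<forall>y\<in>K. (x, y) \<in> le \<longrightarrow> y \<in> U)}"

definition diamond :: "'x set \<Rightarrow> 'x rel \<Rightarrow> 'x set \<Rightarrow> 'x set" where
  "diamond K R U = {x \<in> K. \<exists>y\<in>U. (x, y) \<in> R}"

text \<open>The empty set, as the empty union, belongs to \<open>B\<close> because \<open>K\<close> does and \<open>B\<close> is closed
  under complements. The values of \<open>N\<close> outside \<open>K\<close> are irrelevant.\<close>

locale kn_frame =
  fixes K :: "'x set" and le :: "'x rel" and R :: "'x rel"
    and B :: "'x set set" and N :: "'x \<Rightarrow> 'x set set"
  assumes partial_order: "partial_order_on K le"
    and R_subset: "R \<subseteq> K \<times> K"
    and B_subset: "B \<subseteq> Pow K"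
    and N_subset: "x \<in> K \<Longrightarrow> N x \<subseteq> upsets K le B"
    and R_compatible: "(x, y) \<in> le \<Longrightarrow> (y, z) \<in> R \<Longrightarrow> (x, z) \<in> R"
    and N_mono: "x \<in> K \<Longrightarrow> U \<in> upsets K le B \<Longrightarrow> V \<in> upsets K le B \<Longrightarrow> U \<subseteq> V \<Longrightarrow>
                 U \<in> N x \<Longrightarrow> V \<in> N x"
    and B_carrier: "K \<in> B"
    and B_union: "U \<in> B \<Longrightarrow> V \<in> B \<Longrightarrow> U \<union> V \<in> B"
    and B_complement: "U \<in> B \<Longrightarrow> K - U \<in> B"
    and B_diamond: "U \<in> B \<Longrightarrow> diamond K R U \<in> B"
    and B_neighbourhood: "U \<in> upsets K le B \<Longrightarrow> {x \<in> K. U \<in> N x} \<in> B"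

definition kn_imp ::
    "'x set \<Rightarrow> 'x rel \<Rightarrow> ('x \<Rightarrow> 'x set set) \<Rightarrow> 'x set \<Rightarrow> 'x set \<Rightarrow> 'x set" where
  "kn_imp K R N U V = {x \<in> K. \<forall>y\<in>K. (x, y) \<in> R \<and> U \<in> N y \<longrightarrow> V \<in> N y}"

locale open_kn_frame = kn_frame +
  assumes open_frame:
    "x \<in> K \<Longrightarrow> y \<in> K \<Longrightarrow> U \<in> upsets K le B \<Longrightarrow> V \<in> upsets K le B \<Longrightarrow>
     x \<in> U \<Longrightarrow> (x, y) \<in> R \<Longrightarrow> V \<in> N y \<Longrightarrow> U \<inter> V \<in> N y"

definition clopens :: "'x topology \<Rightarrow> 'x set set" where
  "clopens X = {U. openin X U \<and> closedin X U}"

locale priestley_space =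
  fixes X :: "'x topology" and le :: "'x rel"
  assumes compact: "compact_space X"
    and partial_order: "partial_order_on (topspace X) le"
    and separation: "x \<in> topspace X \<Longrightarrow> y \<in> topspace X \<Longrightarrow> (x, y) \<notin> le \<Longrightarrow>
                     \<exists>U \<in> upsets (topspace X) le (clopens X). x \<in> U \<and> y \<notin> U"

definition kn_space ::
    "'x topology \<Rightarrow> 'x rel \<Rightarrow> 'x rel \<Rightarrow> ('x \<Rightarrow> 'x set set) \<Rightarrow> bool" where
  "kn_space X le R N \<longleftrightarrow>
     priestley_space X le \<and> kn_frame (topspace X) le R (clopens X) N"

definition open_kn_space ::
    "'x topology \<Rightarrow> 'x rel \<Rightarrow> 'x rel \<Rightarrow> ('x \<Rightarrow> 'x set set) \<Rightarrow> bool" where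
  "open_kn_space X le R N \<longleftrightarrow>
     kn_space X le R N \<and> open_kn_frame (topspace X) le R (clopens X) N"

definition kn_embedding ::
    "('a::{distrib_lattice,bounded_lattice} \<Rightarrow> 'a \<Rightarrow> 'a) \<Rightarrow>
     'x topology \<Rightarrow> 'x rel \<Rightarrow> 'x rel \<Rightarrow> ('x \<Rightarrow> 'x set set) \<Rightarrow> ('a \<Rightarrow> 'x set) \<Rightarrow> bool" where
  "kn_embedding imp X le R N i \<longleftrightarrow>
     range i \<subseteq> upsets (topspace X) le (clopens X) \<and>
     inj i \<and>
     i bot = {} \<and> i top = topspace X \<and>
     (\<forall>a b. i (inf a b) = i a \<inter> i b) \<and>
     (\<forall>a b. i (sup a b) = i a \<union> i b) \<and>
     (\<forall>a b. i (imp a b) = kn_imp (topspace X) R N (i a) (i b))"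

end

theory Submission
  imports Defs "HOL-Analysis.Function_Topology"
begin

text \<open>The points of \<open>X\<close> are pairs \<open>(P, S)\<close> of a prime filter and an arbitrary upset of the
  algebra, ordered by inclusion in both components and topologised as a closed subspace of a Cantor
  cube; \<open>i a\<close> consists of the pairs with \<open>a \<in> P\<close>. Every prime filter \<open>P\<close> turns the implication
  into a preorder on the algebra, namely \<open>a \<rightarrow> b \<in> P\<close>, and \<open>(P, S)\<close> is \<open>R\<close>-related to \<open>(Q, T)\<close>
  if \<open>T\<close> is an upset of that preorder; principal upsets then witness every failure of \<open>a \<rightarrow> b \<in> P\<close>.
  A clopen upset \<open>U\<close> is evaluated at \<open>(Q, T)\<close> through its slice \<open>{P. (P, UNIV) \<in> U}\<close>, which has
  the form \<open>{P. c \<in> P}\<close> by compactness: \<open>U \<in> N (Q, T)\<close> iff \<open>c \<in> T\<close>. Taking the slice at the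
  greatest upset \<open>UNIV\<close> is what makes the frame open when the implication is, because
  \<open>(P, S) \<in> U\<close> forces \<open>(P, UNIV) \<in> U\<close>.\<close>

section \<open>Prime filters\<close>

text \<open>Equivalently, membership in \<open>P\<close> is a bounded lattice homomorphism to the
  two-element lattice. As a conjunction of conditions on finitely many elements each, it cuts out a
  closed subset of the cube.\<close>

definition prime_filter :: "'a::{distrib_lattice,bounded_lattice} set \<Rightarrow> bool" where
  "prime_filter P \<longleftrightarrow> top \<in> P \<and> bot \<notin> P \<and>
     (\<forall>a b. inf a b \<in> P \<longleftrightarrow> a \<in> P \<and> b \<in> P) \<and> (\<forall>a b. sup a b \<in> P \<longleftrightarrow> a \<in> P \<or> b \<in> P)"

lemma prime_filter_top: "prime_filter P \<Longrightarrow> top \<in> P"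
  and prime_filter_bot: "prime_filter P \<Longrightarrow> bot \<notin> P"
  and prime_filter_inf: "prime_filter P \<Longrightarrow> inf a b \<in> P \<longleftrightarrow> a \<in> P \<and> b \<in> P"
  and prime_filter_sup: "prime_filter P \<Longrightarrow> sup a b \<in> P \<longleftrightarrow> a \<in> P \<or> b \<in> P"
  by (simp_all add: prime_filter_def)

lemma prime_filter_mono: "prime_filter P \<Longrightarrow> a \<in> P \<Longrightarrow> a \<le> b \<Longrightarrow> b \<in> P"
  by (metis inf.absorb_iff1 prime_filter_inf)

text \<open>Zorn's lemma gives a filter maximal among those containing \<open>a\<close> and omitting
  \<open>b\<close>; distributivity makes it prime.\<close>

lemma prime_filter_separation:
  fixes a b :: "'a::{distrib_lattice,bounded_lattice}"
  assumes "\<not> a \<le> b"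
  obtains P where "prime_filter P" "a \<in> P" "b \<notin> P"
proof -
  define \<F> where "\<F> = {F. a \<in> F \<and> b \<notin> F \<and> (\<forall>x\<in>F. \<forall>y\<in>F. inf x y \<in> F) \<and> (\<forall>x\<in>F. \<forall>y. x \<le> y \<longrightarrow> y \<in> F)}"
  have "\<exists>M\<in>\<F>. \<forall>F\<in>\<F>. M \<subseteq> F \<longrightarrow> F = M"
  proof (rule subset_Zorn_nonempty)
    have "{x. a \<le> x} \<in> \<F>"
      using assms by (auto simp: \<F>_def)
    then show "\<F> \<noteq> {}" by blast
  next
    fix \<C> assume ne: "\<C> \<noteq> {}" and ch: "subset.chain \<F> \<C>"
    have sub: "\<C> \<subseteq> \<F>" and tot: "\<And>F G. F \<in> \<C> \<Longrightarrow> G \<in> \<C> \<Longrightarrow> F \<subseteq> G \<or> G \<subseteq> F"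
      using ch by (auto simp: subset.chain_def)
    have mem: "a \<in> F" "b \<notin> F" "\<And>x y. x \<in> F \<Longrightarrow> y \<in> F \<Longrightarrow> inf x y \<in> F"
        "\<And>x y. x \<in> F \<Longrightarrow> x \<le> y \<Longrightarrow> y \<in> F"
      if "F \<in> \<C>" for F
      using subsetD[OF sub that] by (simp_all add: \<F>_def)
    have "inf x y \<in> \<Union>\<C>" if "F \<in> \<C>" "x \<in> F" "G \<in> \<C>" "y \<in> G" for x y F G
      using tot[OF that(1,3)] that mem(3) by (meson UnionI subsetD)
    then have "\<forall>x\<in>\<Union>\<C>. \<forall>y\<in>\<Union>\<C>. inf x y \<in> \<Union>\<C>"
      by blast
    moreover have "a \<in> \<Union>\<C>" "b \<notin> \<Union>\<C>" "\<forall>x\<in>\<Union>\<C>. \<forall>y. x \<le> y \<longrightarrow> y \<in> \<Union>\<C>"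
      using ne mem(1,2,4) by blast+
    ultimately show "\<Union>\<C> \<in> \<F>"
      by (simp add: \<F>_def)
  qed
  then obtain M where M: "M \<in> \<F>" and max: "\<And>F. F \<in> \<F> \<Longrightarrow> M \<subseteq> F \<Longrightarrow> F = M"
    by blast
  have aM: "a \<in> M" and bM: "b \<notin> M" and infM: "\<And>x y. x \<in> M \<Longrightarrow> y \<in> M \<Longrightarrow> inf x y \<in> M"
    and upM: "\<And>x y. x \<in> M \<Longrightarrow> x \<le> y \<Longrightarrow> y \<in> M"
    using M by (auto simp: \<F>_def)
  \<comment> \<open>By maximality, the filter generated by \<open>M\<close> and an outside element
    \<open>x\<close> must contain \<open>b\<close>.\<close>
  have ext: "\<exists>m\<in>M. inf m x \<le> b" if "x \<notin> M" for x
  proof (rule ccontr)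
    assume neg: "\<not> ?thesis"
    let ?F = "{z. \<exists>m\<in>M. inf m x \<le> z}"
    have "inf z w \<in> ?F" if z: "z \<in> ?F" and w: "w \<in> ?F" for z w
    proof -
      obtain m n where "m \<in> M" "inf m x \<le> z" "n \<in> M" "inf n x \<le> w"
        using z w by blast
      moreover from this have "inf (inf m n) x \<le> z" "inf (inf m n) x \<le> w"
        by (meson inf_le1 inf_le2 inf_mono order.refl order.trans)+
      ultimately show ?thesis
        using infM by auto
    qed
    moreover have "a \<in> ?F" "b \<notin> ?F" "\<forall>z\<in>?F. \<forall>y. z \<le> y \<longrightarrow> y \<in> ?F"
      using aM neg by (auto intro: order.trans le_infI1)
    ultimately have "?F \<in> \<F>"
      unfolding \<F>_def by blast
    moreover have "M \<subseteq> ?F"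
      using inf_le1 by blast
    ultimately have "?F = M"
      by (rule max)
    moreover have "x \<in> ?F"
      using aM inf_le2 by blast
    ultimately show False
      using that by simp
  qed
  have "x \<in> M \<or> y \<in> M" if "sup x y \<in> M" for x y
  proof (rule ccontr)
    assume "\<not> ?thesis"
    then obtain m n where mn: "m \<in> M" "n \<in> M" "inf m x \<le> b" "inf n y \<le> b"
      using ext by meson
    \<comment> \<open>One common meet \<open>inf m n\<close> serves both \<open>x\<close> and
      \<open>y\<close>, so that distributivity bounds its meet with \<open>sup x y\<close> by
      \<open>b\<close>.\<close>
    have "inf (inf m n) x \<le> b" "inf (inf m n) y \<le> b"
      using mn(3,4) by (meson inf_le1 inf_le2 inf_mono order.refl order.trans)+
    then have "inf (inf m n) (sup x y) \<le> b"
      by (simp add: inf_sup_distrib1)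
    then show False
      using upM[OF infM[OF infM[OF mn(1,2)] that]] bM by blast
  qed
  then have "prime_filter M"
    unfolding prime_filter_def
    using aM bM infM upM by (meson bot_least inf_le1 inf_le2 sup_ge1 sup_ge2 top_greatest)
  then show thesis
    using that aM bM by blast
qed

lemma le_iff_prime_filters:
  fixes a b :: "'a::{distrib_lattice,bounded_lattice}"
  shows "a \<le> b \<longleftrightarrow> (\<forall>P. prime_filter P \<longrightarrow> a \<in> P \<longrightarrow> b \<in> P)"
  by (meson prime_filter_mono prime_filter_separation)

section \<open>The space of points\<close>

text \<open>Read \<open>Q a W\<close> as: the index \<open>a\<close> works on all of the open set
  \<open>W\<close>. A finite subcover involves finitely many indices, and directedness merges them
  into a single one.\<close>

lemma compactin_directed:
  assumes C: "compactin X C" and ne: "\<A> \<noteq> {}"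
    and dir: "\<And>a b. a \<in> \<A> \<Longrightarrow> b \<in> \<A> \<Longrightarrow> \<exists>c\<in>\<A>. \<forall>W. Q a W \<or> Q b W \<longrightarrow> Q c W"
    and local: "\<And>y. y \<in> C \<Longrightarrow> \<exists>a\<in>\<A>. \<exists>W. openin X W \<and> y \<in> W \<and> Q a W"
  shows "\<exists>a\<in>\<A>. \<forall>y\<in>C. \<exists>W. y \<in> W \<and> Q a W"
proof -
  let ?\<U> = "{W. openin X W \<and> (\<exists>a\<in>\<A>. Q a W)}"
  have "C \<subseteq> \<Union>?\<U>"
    using local by blast
  then obtain \<W> where fin: "finite \<W>" and sub: "\<W> \<subseteq> ?\<U>" and cover: "C \<subseteq> \<Union>\<W>"
    using compactinD[OF C, of ?\<U>] by auto
  from sub have \<W>: "\<forall>W\<in>\<W>. \<exists>a\<in>\<A>. Q a W"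
    by blast
  from fin \<W> have "\<exists>a\<in>\<A>. \<forall>W\<in>\<W>. Q a W"
  proof induction
    case empty
    then show ?case using ne by blast
  next
    case (insert W \<W>)
    then obtain a b where ab: "a \<in> \<A>" "b \<in> \<A>" "\<forall>W\<in>\<W>. Q a W" "Q b W"
      by auto
    then show ?case
      using dir[OF ab(1,2)] by blast
  qed
  then obtain a where "a \<in> \<A>" "\<forall>W\<in>\<W>. Q a W"
    by blast
  then have "\<forall>y\<in>C. \<exists>W. y \<in> W \<and> Q a W"
    using cover by (meson UnionE subsetD)
  then show ?thesis
    using \<open>a \<in> \<A>\<close> by (rule bexI)
qed

section \<open>The Cantor topology on pairs of sets\<close>

definition pair_subbase :: "('a set \<times> 'a set) set set" where
  "pair_subbase = (\<Union>a. {{x. a \<in> fst x}, {x. a \<notin> fst x}, {x. a \<in> snd x}, {x. a \<notin> snd x}})"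

text \<open>Up to characteristic functions this is the Cantor cube over \<open>'a + 'a\<close>: the
  subbase fixes one coordinate to true or false.\<close>

definition pair_topology :: "('a set \<times> 'a set) topology" where
  "pair_topology = topology_generated_by pair_subbase"

definition points :: "('a::{distrib_lattice,bounded_lattice} set \<times> 'a set) set" where
  "points = {(P, S). prime_filter P \<and> (\<forall>a b. a \<in> S \<longrightarrow> a \<le> b \<longrightarrow> b \<in> S)}"

definition point_space :: "('a::{distrib_lattice,bounded_lattice} set \<times> 'a set) topology" where
  "point_space = subtopology pair_topology points"

definition point_le :: "('a::{distrib_lattice,bounded_lattice} set \<times> 'a set) rel" where
  "point_le = {(x, y). x \<in> points \<and> y \<in> points \<and> fst x \<subseteq> fst y \<and> snd x \<subseteq> snd y}"

abbreviation point_upsets :: "('a::{distrib_lattice,bounded_lattice} set \<times> 'a set) set set" where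
  "point_upsets \<equiv> upsets points point_le (clopens point_space)"

definition stone :: "'a::{distrib_lattice,bounded_lattice} \<Rightarrow> ('a set \<times> 'a set) set" where
  "stone a = {x \<in> points. a \<in> fst x}"

lemma topspace_pair_topology [simp]: "topspace pair_topology = UNIV"
proof -
  have "x \<in> \<Union>pair_subbase" for x :: "'a set \<times> 'a set"
    \<comment> \<open>Any fixed element would do: two complementary subbasic sets already cover all
      pairs.\<close>
    by (cases "undefined \<in> fst x") (auto simp: pair_subbase_def)
  then show ?thesis
    unfolding pair_topology_def topology_generated_by_topspace by blast
qed

lemma pair_topology_subbase:
  "openin pair_topology {x. a \<in> fst x}" "openin pair_topology {x. a \<notin> fst x}"
  "openin pair_topology {x. a \<in> snd x}" "openin pair_topology {x. a \<notin> snd x}"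
  unfolding pair_topology_def pair_subbase_def
  by (rule topology_generated_by_Basis, blast)+

lemma pair_topology_closed:
  "closedin pair_topology {x. a \<in> fst x}" "closedin pair_topology {x. a \<notin> fst x}"
  "closedin pair_topology {x. a \<in> snd x}" "closedin pair_topology {x. a \<notin> snd x}"
  using pair_topology_subbase[of a] by (simp_all add: closedin_def Compl_eq_Diff_UNIV[symmetric] Collect_neg_eq[symmetric])

text \<open>The cube \<open>Y\<close> is compact by Tychonoff's theorem, and \<open>g\<close> maps
  it continuously onto the space of pairs.\<close>

lemma compact_space_pair_topology: "compact_space (pair_topology :: ('a set \<times> 'a set) topology)"
proof -
  define Y :: "('a + 'a \<Rightarrow> bool) topology" where
    "Y = product_topology (\<lambda>_. discrete_topology UNIV) UNIV"
  define g :: "('a + 'a \<Rightarrow> bool) \<Rightarrow> 'a set \<times> 'a set" where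
    "g = (\<lambda>h. ({a. h (Inl a)}, {a. h (Inr a)}))"
  have Y: "topspace Y = UNIV" "compact_space Y"
    by (simp_all add: Y_def compact_space_product_topology compact_space_discrete_topology)
  have coord: "openin Y {h. h z = v}" for z v
  proof -
    have "continuous_map Y (discrete_topology UNIV) (\<lambda>h. h z)"
      unfolding Y_def by (rule continuous_map_product_projection) simp
    then have "openin Y {h \<in> topspace Y. h z \<in> {v}}"
      by (rule openin_continuous_map_preimage) simp
    then show ?thesis
      by (simp add: Y)
  qed
  have "continuous_map Y pair_topology g"
    unfolding pair_topology_def
  proof (rule continuous_on_generated_topo)
    show "g ` topspace Y \<subseteq> \<Union>pair_subbase"
      using topspace_pair_topology unfolding pair_topology_def topology_generated_by_topspace
      by blast
    fix U :: "('a set \<times> 'a set) set" assume "U \<in> pair_subbase"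
    then show "openin Y (g -` U \<inter> topspace Y)"
      using coord[of _ True] coord[of _ False] by (auto simp: pair_subbase_def g_def Y vimage_def)
  qed
  moreover have "g ` topspace Y = UNIV"
  proof -
    have "z = g (case_sum (\<lambda>a. a \<in> fst z) (\<lambda>a. a \<in> snd z))" for z
      by (simp add: g_def)
    then show ?thesis
      using Y(1) by blast
  qed
  ultimately show ?thesis
    using Y(2) unfolding compact_space_def by (metis image_compactin topspace_pair_topology)
qed

text \<open>With negations pushed down to the atoms, the defining condition is built from clopen
  coordinate conditions by finite disjunctions and arbitrary conjunctions.\<close>

lemma closedin_points:
  "closedin pair_topology (points :: ('a::{distrib_lattice,bounded_lattice} set \<times> 'a set) set)"
proof -
  let ?T = "pair_topology :: ('a set \<times> 'a set) topology"
  have all: "closedin ?T {x. \<forall>a. \<phi> a x}" if "\<And>a. closedin ?T {x. \<phi> a x}" for \<phi> :: "'a \<Rightarrow> _"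
  proof -
    have "closedin ?T (\<Inter>a. {x. \<phi> a x})"
      using that by (intro closedin_Inter) auto
    then show ?thesis by (simp add: Collect_all_eq)
  qed
  have conj: "closedin ?T {x. \<phi> x \<and> \<psi> x}" if "closedin ?T {x. \<phi> x}" "closedin ?T {x. \<psi> x}" for \<phi> \<psi>
    using closedin_Int[OF that] by (simp add: Collect_conj_eq)
  have disj: "closedin ?T {x. \<phi> x \<or> \<psi> x}" if "closedin ?T {x. \<phi> x}" "closedin ?T {x. \<psi> x}" for \<phi> \<psi>
    using closedin_Un[OF that] by (simp add: Collect_disj_eq)
  \<comment> \<open>Handles the condition \<open>\<not> a \<le> b\<close> in the upset clause, which
    does not depend on the point.\<close>
  have const: "closedin ?T {x. c}" for c
    using closedin_topspace[of ?T] by (cases c) simp_all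
  have eq: "(p \<longleftrightarrow> q) \<longleftrightarrow> (p \<and> q) \<or> (\<not> p \<and> \<not> q)" for p q
    by blast
  have "points = {x :: 'a set \<times> 'a set. prime_filter (fst x) \<and> (\<forall>a b. a \<in> snd x \<longrightarrow> a \<le> b \<longrightarrow> b \<in> snd x)}"
    by (auto simp: points_def)
  also have "closedin ?T \<dots>"
    unfolding prime_filter_def eq imp_conv_disj de_Morgan_conj de_Morgan_disj
    by (intro all conj disj const pair_topology_closed)
  finally show ?thesis .
qed

section \<open>Coordinate sets and the Priestley property\<close>

lemma topspace_point_space [simp]: "topspace point_space = points"
  by (simp add: point_space_def)

lemma compact_space_point_space: "compact_space point_space"
  unfolding point_space_def
  by (intro compact_space_subtopology closedin_compact_space compact_space_pair_topology closedin_points)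

lemma pointsD: "x \<in> points \<Longrightarrow> prime_filter (fst x)" "x \<in> points \<Longrightarrow> a \<in> snd x \<Longrightarrow> a \<le> b \<Longrightarrow> b \<in> snd x"
  by (auto simp: points_def)

lemma clopen_stone: "stone a \<in> clopens point_space"
  and clopen_snd: "{x \<in> points. a \<in> snd x} \<in> clopens point_space"
proof -
  have *: "points \<inter> U \<in> clopens point_space" if "openin pair_topology U" "closedin pair_topology U"
    for U :: "('a set \<times> 'a set) set"
    using that by (simp add: clopens_def point_space_def openin_subtopology_Int2 closedin_subtopology_Int_closed)
  show "stone a \<in> clopens point_space"
    using *[OF pair_topology_subbase(1) pair_topology_closed(1)] by (simp add: stone_def Collect_conj_eq)
  show "{x \<in> points. a \<in> snd x} \<in> clopens point_space"
    using *[OF pair_topology_subbase(3) pair_topology_closed(3)] by (simp add: Collect_conj_eq)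
qed

lemma stone_upset: "stone a \<in> point_upsets"
  using clopen_stone[of a] by (auto simp: upsets_def stone_def point_le_def)

lemma snd_upset: "{x \<in> points. a \<in> snd x} \<in> point_upsets"
  using clopen_snd[of a] by (auto simp: upsets_def point_le_def)

lemma stone_lattice:
  "stone bot = {}" "stone top = points"
  "stone (inf a b) = stone a \<inter> stone b" "stone (sup a b) = stone a \<union> stone b"
  by (auto simp: stone_def dest: pointsD(1) simp: prime_filter_top prime_filter_bot prime_filter_inf prime_filter_sup)

lemma points_UNIV: "(P, UNIV) \<in> points \<longleftrightarrow> prime_filter P"
  by (simp add: points_def)

text \<open>Every prime filter is the first component of some point, for instance with
  \<open>UNIV\<close> as the second, so separation by prime filters applies.\<close>

lemma inj_stone: "inj stone"
proof (rule injI)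
  fix a b :: 'a assume "stone a = stone b"
  then have "a \<in> P \<longleftrightarrow> b \<in> P" if "prime_filter P" for P
    using that by (metis (mono_tags, lifting) fst_conv mem_Collect_eq points_UNIV stone_def)
  then show "a = b"
    by (intro order.antisym) (auto simp: le_iff_prime_filters)
qed

lemma partial_order_point_le: "partial_order_on points point_le"
  by (auto simp: partial_order_on_def preorder_on_def refl_on_def trans_def antisym_def point_le_def
      prod_eq_iff)

text \<open>A failure of the order is witnessed by one element in one component, and the
  corresponding coordinate set is a clopen upset.\<close>

lemma priestley_space_points: "priestley_space point_space point_le"
proof
  show "compact_space point_space"
    by (rule compact_space_point_space)
  show "partial_order_on (topspace point_space) point_le"
    by (simp add: partial_order_point_le)
  fix x y :: "'a set \<times> 'a set"
  assume "x \<in> topspace point_space" "y \<in> topspace point_space" "(x, y) \<notin> point_le"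
  then consider a where "a \<in> fst x" "a \<notin> fst y" | a where "a \<in> snd x" "a \<notin> snd y"
    by (auto simp: point_le_def)
  then show "\<exists>U \<in> upsets (topspace point_space) point_le (clopens point_space). x \<in> U \<and> y \<notin> U"
  proof cases
    case 1
    then show ?thesis
      using \<open>x \<in> _\<close> by (intro bexI[OF _ stone_upset[of a, folded topspace_point_space]])
        (auto simp: stone_def)
  next
    case 2
    then show ?thesis
      using \<open>x \<in> _\<close> by (intro bexI[OF _ snd_upset[of a, folded topspace_point_space]]) auto
  qed
qed

section \<open>Clopen sets and the slice at the greatest upset\<close>

lemma clopens_subset: "U \<in> clopens X \<Longrightarrow> U \<subseteq> topspace X"
  by (simp add: clopens_def openin_subset)

lemma clopens_Diff:
  "U \<in> clopens X \<Longrightarrow> V \<in> clopens X \<Longrightarrow> U - V \<in> clopens X"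
  by (auto simp: clopens_def)

lemma clopens_Un: "U \<in> clopens X \<Longrightarrow> V \<in> clopens X \<Longrightarrow> U \<union> V \<in> clopens X"
  and clopens_Int: "U \<in> clopens X \<Longrightarrow> V \<in> clopens X \<Longrightarrow> U \<inter> V \<in> clopens X"
  by (simp_all add: clopens_def openin_Un closedin_Un openin_Int closedin_Int)

lemma clopens_topspace: "topspace X \<in> clopens X"
  by (simp add: clopens_def)

lemma clopen_compactin: "U \<in> clopens point_space \<Longrightarrow> compactin point_space U"
  using closedin_compact_space[OF compact_space_point_space] by (auto simp: clopens_def)

lemma clopen_Compl: "U \<in> clopens point_space \<Longrightarrow> points - U \<in> clopens point_space"
  using clopens_Diff[OF clopens_topspace] by fastforce

lemma closedin_slice: "closedin point_space {x \<in> points. snd x = UNIV}"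
proof -
  have "closedin point_space (\<Inter>a. {x \<in> points. a \<in> snd x})"
    using clopen_snd by (intro closedin_Inter) (auto simp: clopens_def)
  also have "(\<Inter>a. {x \<in> points. a \<in> snd x}) = {x \<in> points. snd x = UNIV}"
    by auto
  finally show ?thesis .
qed

text \<open>The slice is a copy of the Priestley dual of the algebra, and this is the classical
  representation of its clopen upsets. Two compactness arguments are used: one puts a set
  \<open>stone a\<close> around each point of \<open>U\<close> in the slice, the other joins
  finitely many of these.\<close>

lemma slice_eq_stone:
  fixes U :: "('a::{distrib_lattice,bounded_lattice} set \<times> 'a set) set"
  assumes U: "U \<in> point_upsets"
  obtains c where "\<And>P. prime_filter P \<Longrightarrow> (P, UNIV) \<in> U \<longleftrightarrow> c \<in> P"
proof -
  have clopen: "U \<in> clopens point_space" and Us: "U \<subseteq> points"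
    and up: "\<And>x y. x \<in> U \<Longrightarrow> y \<in> points \<Longrightarrow> (x, y) \<in> point_le \<Longrightarrow> y \<in> U"
    using U by (auto simp: upsets_def)
  let ?K = "{x \<in> points. snd x = UNIV} :: ('a set \<times> 'a set) set"
  have stone_open: "openin point_space (stone a)" "openin point_space (points - stone a)" for a :: 'a
    using clopen_stone[of a] by (auto simp: clopens_def closedin_def)
  \<comment> \<open>The part of the slice outside \<open>U\<close> is compact, and the elements of
    \<open>fst x\<close> are directed under \<open>inf\<close>; one of them separates
    \<open>x\<close> from that whole part.\<close>
  have inner: "\<exists>a. x \<in> stone a \<and> stone a \<inter> ?K \<subseteq> U" if x: "x \<in> U \<inter> ?K" for x
  proof -
    have "\<exists>a\<in>fst x. \<forall>y\<in>(points - U) \<inter> ?K. \<exists>W. y \<in> W \<and> stone a \<inter> W = {}"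
    proof (rule compactin_directed[where X = point_space and Q = "\<lambda>a W. stone a \<inter> W = {}"])
      show "compactin point_space ((points - U) \<inter> ?K)"
        using clopen_compactin[OF clopen_Compl[OF clopen]] closedin_slice by (rule compact_Int_closedin)
      have P: "prime_filter (fst x)"
        using x pointsD(1) by blast
      show "fst x \<noteq> {}"
        using prime_filter_top[OF P] by blast
      show "\<exists>c\<in>fst x. \<forall>W. stone a \<inter> W = {} \<or> stone b \<inter> W = {} \<longrightarrow> stone c \<inter> W = {}"
        if "a \<in> fst x" "b \<in> fst x" for a b
        using that by (intro bexI[of _ "inf a b"]) (auto simp: stone_lattice prime_filter_inf[OF P])
      fix y assume y: "y \<in> (points - U) \<inter> ?K"
      \<comment> \<open>Within the slice the order is inclusion of first components, and
        \<open>U\<close> is an upset.\<close>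
      then have "\<not> fst x \<subseteq> fst y"
        using x up[of x y] by (auto simp: point_le_def)
      then obtain a where "a \<in> fst x" "a \<notin> fst y"
        by blast
      then show "\<exists>a\<in>fst x. \<exists>W. openin point_space W \<and> y \<in> W \<and> stone a \<inter> W = {}"
        using y stone_open(2)[of a]
        by (intro bexI[of _ a] exI[of _ "points - stone a"]) (auto simp: stone_def)
    qed
    then show ?thesis
      using x by (fastforce simp: stone_def)
  qed
  \<comment> \<open>Now the elements whose stone sets lie inside \<open>U\<close> on the slice are
    directed under \<open>sup\<close>, and by \<open>inner\<close> their stone sets cover
    \<open>U\<close> there.\<close>
  have "\<exists>c\<in>{c. stone c \<inter> ?K \<subseteq> U}. \<forall>y\<in>U \<inter> ?K. \<exists>W. y \<in> W \<and> W \<subseteq> stone c"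
  proof (rule compactin_directed[where X = point_space and Q = "\<lambda>c W. W \<subseteq> stone c"])
    show "compactin point_space (U \<inter> ?K)"
      using clopen_compactin[OF clopen] closedin_slice by (rule compact_Int_closedin)
    show "{c. stone c \<inter> ?K \<subseteq> U} \<noteq> {}"
      using stone_lattice(1) by blast
    show "\<exists>c\<in>{c. stone c \<inter> ?K \<subseteq> U}. \<forall>W. W \<subseteq> stone a \<or> W \<subseteq> stone b \<longrightarrow> W \<subseteq> stone c"
      if "a \<in> {c. stone c \<inter> ?K \<subseteq> U}" "b \<in> {c. stone c \<inter> ?K \<subseteq> U}" for a b
      using that by (intro bexI[of _ "sup a b"]) (auto simp: stone_lattice)
    show "\<exists>a\<in>{c. stone c \<inter> ?K \<subseteq> U}. \<exists>W. openin point_space W \<and> y \<in> W \<and> W \<subseteq> stone a"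
      if "y \<in> U \<inter> ?K" for y
      using inner[OF that] stone_open(1) by blast
  qed
  then obtain c where "stone c \<inter> ?K \<subseteq> U" "U \<inter> ?K \<subseteq> stone c"
    by blast
  then have "(P, UNIV) \<in> U \<longleftrightarrow> c \<in> P" if "prime_filter P" for P
    using that points_UNIV[of P] by (auto simp: stone_def subset_iff)
  then show thesis
    by (rule that)
qed

text \<open>With \<open>Q\<close> held fixed, a neighbourhood constrains \<open>T\<close> at
  finitely many elements only: those in \<open>A\<close> must stay in, those in \<open>B\<close>
  must stay out. Subbasic conditions on the first component add nothing to \<open>A\<close> or
  \<open>B\<close>.\<close>

lemma open_pair_topology_snd:
  assumes "openin pair_topology U" "(Q, T) \<in> U"
  obtains A B where "finite A" "finite B" "A \<subseteq> T" "B \<inter> T = {}"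
    "\<And>T'. A \<subseteq> T' \<Longrightarrow> B \<inter> T' = {} \<Longrightarrow> (Q, T') \<in> U"
proof -
  have "generate_topology_on pair_subbase U"
    using assms(1) unfolding pair_topology_def by (rule openin_topology_generated_by)
  then have "\<exists>A B. finite A \<and> finite B \<and> A \<subseteq> T \<and> B \<inter> T = {} \<and>
      (\<forall>T'. A \<subseteq> T' \<longrightarrow> B \<inter> T' = {} \<longrightarrow> (Q, T') \<in> U)"
    using assms(2)
  proof induction
    case Empty
    then show ?case by simp
  next
    case (Int U V)
    then have "(Q, T) \<in> U" "(Q, T) \<in> V"
      by simp_all
    with Int.IH obtain A B A' B' where
      AB: "finite A" "finite B" "A \<subseteq> T" "B \<inter> T = {}"
        "\<And>T'. A \<subseteq> T' \<Longrightarrow> B \<inter> T' = {} \<Longrightarrow> (Q, T') \<in> U" and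
      AB': "finite A'" "finite B'" "A' \<subseteq> T" "B' \<inter> T = {}"
        "\<And>T'. A' \<subseteq> T' \<Longrightarrow> B' \<inter> T' = {} \<Longrightarrow> (Q, T') \<in> V"
      by (metis (no_types))
    show ?case
      using AB(1-4) AB'(1-4)
      by (intro exI[of _ "A \<union> A'"] exI[of _ "B \<union> B'"])
        (simp add: Int_Un_distrib2 AB(5) AB'(5))
  next
    case (UN \<U>)
    then obtain U where "U \<in> \<U>" "(Q, T) \<in> U" by blast
    with UN.IH[OF this] show ?case by (meson UnionI)
  next
    case (Basis U)
    then consider a where "U = {x. a \<in> fst x}" | a where "U = {x. a \<notin> fst x}"
      | a where "U = {x. a \<in> snd x}" | a where "U = {x. a \<notin> snd x}"
      by (auto simp: pair_subbase_def)
    then show ?case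
    proof cases
      case 3
      with Basis show ?thesis by (intro exI[of _ "{a}"] exI[of _ "{}"]) auto
    next
      case 4
      with Basis show ?thesis by (intro exI[of _ "{}"] exI[of _ "{a}"]) auto
    qed (use Basis in \<open>intro exI[of _ "{}"], auto\<close>)+
  qed
  then show thesis
    using that by blast
qed

section \<open>The KN-structure\<close>

definition point_rel :: "('a::{distrib_lattice,bounded_lattice} \<Rightarrow> 'a \<Rightarrow> 'a) \<Rightarrow> ('a set \<times> 'a set) rel" where
  "point_rel imp = {(x, y). x \<in> points \<and> y \<in> points \<and>
     (\<forall>a b. imp a b \<in> fst x \<longrightarrow> a \<in> snd y \<longrightarrow> b \<in> snd y)}"

text \<open>The existential form makes monotonicity in \<open>U\<close> immediate and avoids
  choosing the element that represents the slice; \<open>point_nbhds_iff\<close> recovers evaluation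
  at that element.\<close>

definition point_nbhds :: "'a::{distrib_lattice,bounded_lattice} set \<times> 'a set \<Rightarrow> ('a set \<times> 'a set) set set" where
  "point_nbhds y = {U \<in> point_upsets.
     \<exists>c\<in>snd y. \<forall>P. prime_filter P \<longrightarrow> c \<in> P \<longrightarrow> (P, UNIV) \<in> U}"

text \<open>A witness \<open>d\<close> is exactly an element of \<open>snd y\<close> below
  \<open>c\<close>, by separation with prime filters; since \<open>snd y\<close> is an upset, one
  exists iff \<open>c\<close> itself is in it.\<close>

lemma point_nbhds_iff:
  assumes "U \<in> point_upsets" "y \<in> points"
    and "\<And>P. prime_filter P \<Longrightarrow> (P, UNIV) \<in> U \<longleftrightarrow> c \<in> P"
  shows "U \<in> point_nbhds y \<longleftrightarrow> c \<in> snd y"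
proof -
  have "U \<in> point_nbhds y \<longleftrightarrow> (\<exists>d\<in>snd y. d \<le> c)"
    using assms(1,3) by (auto simp: point_nbhds_def le_iff_prime_filters[of _ c])
  then show ?thesis
    using pointsD(2)[OF assms(2)] by blast
qed

lemma stone_in_point_nbhds:
  assumes "y \<in> points"
  shows "stone a \<in> point_nbhds y \<longleftrightarrow> a \<in> snd y"
  by (rule point_nbhds_iff[OF stone_upset assms]) (simp add: stone_def points_UNIV)

lemma clopen_point_nbhds:
  assumes U: "U \<in> point_upsets"
  shows "{y \<in> points. U \<in> point_nbhds y} \<in> clopens point_space"
proof -
  obtain c where c: "\<And>P. prime_filter P \<Longrightarrow> (P, UNIV) \<in> U \<longleftrightarrow> c \<in> P"
    using slice_eq_stone[OF U] by blast
  have "{y \<in> points. U \<in> point_nbhds y} = {y \<in> points. c \<in> snd y}"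
    using point_nbhds_iff[OF U _ c] by blast
  then show ?thesis
    by (simp add: clopen_snd)
qed

section \<open>The relation induced by an implication\<close>

locale strong_algebra =
  fixes imp :: "'a::{distrib_lattice,bounded_lattice} \<Rightarrow> 'a \<Rightarrow> 'a"
  assumes implication: "is_implication imp"
begin

lemma imp_refl: "imp a a = top"
  and imp_trans: "inf (imp a b) (imp b c) \<le> imp a c"
  and imp_mono: "b \<le> b' \<Longrightarrow> imp a b \<le> imp a b'"
  using implication by (auto simp: is_implication_def)

text \<open>The second component is the upset generated by \<open>A\<close> in the preorder
  \<open>imp a b \<in> fst x\<close>; transitivity of that preorder gives the relation, and
  \<open>imp_mono\<close> makes it an upset of the algebra. The prime filter \<open>Q\<close> is
  arbitrary because the relation puts no further condition on it.\<close>

lemma generated_upset_related: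
  assumes x: "x \<in> points" and Q: "prime_filter Q"
  shows "(x, (Q, {c. \<exists>a\<in>A. imp a c \<in> fst x})) \<in> point_rel imp"
proof -
  note P = pointsD(1)[OF x]
  have step: "imp a c \<in> fst x" if "imp a b \<in> fst x" "imp b c \<in> fst x" for a b c
    using prime_filter_mono[OF P _ imp_trans] prime_filter_inf[OF P] that by blast
  have "(Q, {c. \<exists>a\<in>A. imp a c \<in> fst x}) \<in> points"
    using Q prime_filter_mono[OF P _ imp_mono] by (auto simp: points_def)
  then show ?thesis
    using x step by (auto simp: point_rel_def)
qed

text \<open>By \<open>stone_in_point_nbhds\<close> only membership in second components matters, and
  the principal upset of \<open>a\<close> detects whether \<open>imp a b\<close> lies in
  \<open>fst x\<close>.\<close>

lemma kn_imp_stone: "kn_imp points (point_rel imp) point_nbhds (stone a) (stone b) = stone (imp a b)"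
proof -
  have "(\<forall>y\<in>points. (x, y) \<in> point_rel imp \<and> a \<in> snd y \<longrightarrow> b \<in> snd y) \<longleftrightarrow> imp a b \<in> fst x"
    if x: "x \<in> points" for x
  proof
    assume *: "\<forall>y\<in>points. (x, y) \<in> point_rel imp \<and> a \<in> snd y \<longrightarrow> b \<in> snd y"
    let ?y = "(fst x, {c. \<exists>a\<in>{a}. imp a c \<in> fst x})"
    have "(x, ?y) \<in> point_rel imp"
      using generated_upset_related x pointsD(1) by blast
    moreover have "a \<in> snd ?y"
      using prime_filter_top[OF pointsD(1)[OF x]] by (simp add: imp_refl)
    ultimately have "b \<in> snd ?y"
      using * by (auto simp: point_rel_def)
    then show "imp a b \<in> fst x"
      by simp
  qed (auto simp: point_rel_def)
  then have "kn_imp points (point_rel imp) point_nbhds (stone a) (stone b) = {x \<in> points. imp a b \<in> fst x}"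
    by (auto simp: kn_imp_def stone_in_point_nbhds)
  then show ?thesis
    by (simp only: stone_def[of "imp a b"])
qed

text \<open>A successor \<open>(Q, T)\<close> in \<open>U\<close> depends on \<open>T\<close> only
  through finite sets \<open>A\<close> and \<open>B\<close>. For \<open>z\<close> near
  \<open>x\<close>, the upset generated by \<open>A\<close> at \<open>z\<close> replaces
  \<open>T\<close>.\<close>

lemma openin_diamond:
  assumes U: "U \<in> clopens point_space"
  shows "openin point_space (diamond points (point_rel imp) U)"
proof (subst openin_subopen, intro ballI)
  fix x assume "x \<in> diamond points (point_rel imp) U"
  then obtain Q T where x: "x \<in> points" and QT: "(Q, T) \<in> U" "(x, (Q, T)) \<in> point_rel imp"
    by (auto simp: diamond_def)
  obtain V where V: "openin pair_topology V" "U = V \<inter> points"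
    using U by (auto simp: clopens_def point_space_def openin_subtopology)
  obtain A B where AB: "finite A" "finite B" "A \<subseteq> T" "B \<inter> T = {}"
    and box: "\<And>T'. A \<subseteq> T' \<Longrightarrow> B \<inter> T' = {} \<Longrightarrow> (Q, T') \<in> V"
    using open_pair_topology_snd[OF V(1)] QT V(2) by (metis IntD1)
  have Q: "prime_filter Q"
    using QT V(2) pointsD(1) by fastforce
  \<comment> \<open>Exactly the points \<open>z\<close> at which the upset generated by
    \<open>A\<close> misses \<open>B\<close>. The point \<open>x\<close> is one of them, since
    \<open>T\<close> is closed under its preorder, contains \<open>A\<close> and misses
    \<open>B\<close>.\<close>
  let ?W = "points - (\<Union>(a, b)\<in>A \<times> B. stone (imp a b))"
  have "closedin point_space (\<Union>(a, b)\<in>A \<times> B. stone (imp a b))"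
    using AB clopen_stone by (intro closedin_Union) (auto simp: clopens_def)
  then have "openin point_space ?W"
    by (simp add: closedin_def)
  moreover have "x \<in> ?W"
    using x QT(2) AB by (auto simp: stone_def point_rel_def)
  moreover have "?W \<subseteq> diamond points (point_rel imp) U"
  proof
    fix z assume z: "z \<in> ?W"
    let ?T = "{c. \<exists>a\<in>A. imp a c \<in> fst z}"
    have zp: "z \<in> points"
      using z by blast
    have rel: "(z, (Q, ?T)) \<in> point_rel imp"
      using generated_upset_related zp Q by blast
    have "A \<subseteq> ?T"
      using prime_filter_top[OF pointsD(1)[OF zp]] imp_refl by (metis (mono_tags, lifting) mem_Collect_eq subsetI)
    moreover have "B \<inter> ?T = {}"
      using z by (auto simp: stone_def)
    ultimately have "(Q, ?T) \<in> U"
      using box rel V(2) by (auto simp: point_rel_def)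
    then show "z \<in> diamond points (point_rel imp) U"
      using zp rel by (auto simp: diamond_def)
  qed
  ultimately show "\<exists>W. openin point_space W \<and> x \<in> W \<and> W \<subseteq> diamond points (point_rel imp) U"
    by blast
qed

text \<open>If \<open>x\<close> has no successor in \<open>U\<close>, each \<open>y\<close> in
  \<open>U\<close> is excluded by a single \<open>imp a b\<close> in \<open>fst x\<close>.
  Compactness of \<open>U\<close> combines these into one \<open>d\<close> in \<open>fst x\<close>
  such that no point of \<open>stone d\<close> has a successor in \<open>U\<close>.\<close>

lemma closedin_diamond:
  assumes U: "U \<in> clopens point_space"
  shows "closedin point_space (diamond points (point_rel imp) U)"
proof -
  have Us: "U \<subseteq> points"
    using clopens_subset[OF U] by simp
  have "openin point_space (points - diamond points (point_rel imp) U)"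
  proof (subst openin_subopen, intro ballI)
    fix x assume x: "x \<in> points - diamond points (point_rel imp) U"
    then have P: "prime_filter (fst x)"
      using pointsD(1) by blast
    let ?Q = "\<lambda>d W. point_rel imp \<inter> stone d \<times> W = {}"
    have "\<exists>d\<in>fst x. \<forall>y\<in>U. \<exists>W. y \<in> W \<and> ?Q d W"
    proof (rule compactin_directed[OF clopen_compactin[OF U], where Q = ?Q])
      show "fst x \<noteq> {}"
        using prime_filter_top[OF P] by blast
      show "\<exists>c\<in>fst x. \<forall>W. ?Q a W \<or> ?Q b W \<longrightarrow> ?Q c W" if "a \<in> fst x" "b \<in> fst x" for a b
        using that by (intro bexI[of _ "inf a b"]) (auto simp: stone_lattice prime_filter_inf[OF P])
      fix y assume y: "y \<in> U"
      then obtain a b where ab: "imp a b \<in> fst x" "a \<in> snd y" "b \<notin> snd y"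
        using x Us by (auto simp: diamond_def point_rel_def)
      \<comment> \<open>On this neighbourhood of \<open>y\<close> the same \<open>a\<close> and
        \<open>b\<close> exclude every predecessor whose first component contains
        \<open>imp a b\<close>.\<close>
      let ?W = "{y \<in> points. a \<in> snd y} - {y \<in> points. b \<in> snd y}"
      have "openin point_space ?W"
        using clopens_Diff[OF clopen_snd[of a] clopen_snd[of b]] by (simp add: clopens_def)
      moreover have "?Q (imp a b) ?W"
        by (auto simp: point_rel_def stone_def)
      ultimately show "\<exists>d\<in>fst x. \<exists>W. openin point_space W \<and> y \<in> W \<and> ?Q d W"
        using ab y Us by (intro bexI[of _ "imp a b"] exI[of _ ?W]) auto
    qed
    then obtain d where d: "d \<in> fst x" and disj: "\<And>y. y \<in> U \<Longrightarrow> \<exists>W. y \<in> W \<and> ?Q d W"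
      by blast
    have "stone d \<subseteq> points - diamond points (point_rel imp) U"
      using disj by (fastforce simp: diamond_def stone_def)
    then show "\<exists>W. openin point_space W \<and> x \<in> W \<and> W \<subseteq> points - diamond points (point_rel imp) U"
      using clopen_stone[of d] d x by (intro exI[of _ "stone d"]) (auto simp: clopens_def stone_def)
  qed
  then show ?thesis
    by (auto simp: closedin_def diamond_def)
qed

lemma kn_frame_points: "kn_frame points point_le (point_rel imp) (clopens point_space) point_nbhds"
proof
  fix x :: "'a set \<times> 'a set" and U V :: "('a set \<times> 'a set) set"
  show "partial_order_on points point_le"
    by (rule partial_order_point_le)
  show "point_rel imp \<subseteq> points \<times> points"
    by (auto simp: point_rel_def)
  show "clopens point_space \<subseteq> Pow points"
    using clopens_subset[of _ point_space] by auto
  show "point_nbhds x \<subseteq> point_upsets"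
    by (auto simp: point_nbhds_def)
  \<comment> \<open>A larger first component imposes more closure conditions on the second component
    of a successor.\<close>
  show "(x, z) \<in> point_rel imp" if "(x, y) \<in> point_le" "(y, z) \<in> point_rel imp" for x y z
    using that by (auto simp: point_rel_def point_le_def)
  show "V \<in> point_nbhds x" if "V \<in> point_upsets" "U \<subseteq> V" "U \<in> point_nbhds x"
    using that by (fastforce simp: point_nbhds_def)
  show "points \<in> clopens point_space"
    using clopens_topspace[of point_space] by simp
  show "U \<union> V \<in> clopens point_space"
    if "U \<in> clopens point_space" "V \<in> clopens point_space"
    using that by (rule clopens_Un)
  show "points - U \<in> clopens point_space" if "U \<in> clopens point_space"
    using that by (rule clopen_Compl)
  show "diamond points (point_rel imp) U \<in> clopens point_space" if "U \<in> clopens point_space"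
    using openin_diamond[OF that] closedin_diamond[OF that] by (simp add: clopens_def)
  show "{x \<in> points. U \<in> point_nbhds x} \<in> clopens point_space" if "U \<in> point_upsets"
    using that by (rule clopen_point_nbhds)
qed

text \<open>Let \<open>d\<close> represent the slice of \<open>U\<close> and let \<open>c\<close>
  witness \<open>V \<in> point_nbhds y\<close>. Openness gives
  \<open>d \<le> imp c (inf d c)\<close>, so the relation carries \<open>c\<close> to
  \<open>inf d c\<close> in \<open>snd y\<close>, which witnesses the intersection.\<close>

lemma open_kn_frame_points:
  assumes "open_implication imp"
  shows "open_kn_frame points point_le (point_rel imp) (clopens point_space) point_nbhds"
proof (intro open_kn_frame.intro kn_frame_points open_kn_frame_axioms.intro)
  fix x y :: "'a set \<times> 'a set" and U V
  assume x: "x \<in> points" and U: "U \<in> point_upsets" and V: "V \<in> point_upsets"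
    and xU: "x \<in> U" and xy: "(x, y) \<in> point_rel imp" and Vy: "V \<in> point_nbhds y"
  note P = pointsD(1)[OF x]
  obtain d where d: "\<And>P. prime_filter P \<Longrightarrow> (P, UNIV) \<in> U \<longleftrightarrow> d \<in> P"
    using slice_eq_stone[OF U] by blast
  obtain c where c: "c \<in> snd y" "\<And>P. prime_filter P \<Longrightarrow> c \<in> P \<Longrightarrow> (P, UNIV) \<in> V"
    using Vy by (auto simp: point_nbhds_def)
  \<comment> \<open>Moving up to the slice stays inside \<open>U\<close> and turns membership in
    \<open>U\<close> into \<open>d \<in> fst x\<close>.\<close>
  have "(x, (fst x, UNIV)) \<in> point_le" "(fst x, UNIV) \<in> points"
    using x P by (auto simp: point_le_def points_UNIV)
  then have "(fst x, UNIV) \<in> U"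
    using U xU unfolding upsets_def by blast
  then have "d \<in> fst x"
    using d P by blast
  moreover have "d \<le> imp c (inf d c)"
    using assms by (simp add: open_implication_def)
  ultimately have "imp c (inf d c) \<in> fst x"
    using prime_filter_mono[OF P] by blast
  then have "inf d c \<in> snd y"
    using xy c(1) by (auto simp: point_rel_def)
  moreover have "U \<inter> V \<in> point_upsets"
    using U V by (auto simp: upsets_def clopens_Int)
  moreover have "(P, UNIV) \<in> U \<inter> V" if "prime_filter P" "inf d c \<in> P" for P
    using that c(2) d by (simp add: prime_filter_inf)
  ultimately show "U \<inter> V \<in> point_nbhds y"
    unfolding point_nbhds_def by blast
qed

lemma kn_space_points: "kn_space point_space point_le (point_rel imp) point_nbhds"
  by (simp add: kn_space_def priestley_space_points kn_frame_points)

lemma kn_embedding_stone: "kn_embedding imp point_space point_le (point_rel imp) point_nbhds stone"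
  using stone_upset inj_stone by (auto simp: kn_embedding_def stone_lattice kn_imp_stone)

end

theorem theorem5p3:
  fixes imp :: "'a::{distrib_lattice,bounded_lattice} \<Rightarrow> 'a \<Rightarrow> 'a"
  assumes "is_implication imp"
  shows "(\<exists>(X :: ('a set \<times> 'a set) topology) le R N i.
            kn_space X le R N \<and> kn_embedding imp X le R N i) \<and>
         (open_implication imp \<longrightarrow>
           (\<exists>(X :: ('a set \<times> 'a set) topology) le R N i.
              open_kn_space X le R N \<and> kn_embedding imp X le R N i))"
proof -
  interpret strong_algebra imp
    using assms by unfold_locales
  \<comment> \<open>The same space and embedding serve both claims; openness of the implication only
    adds openness of the frame.\<close>
  have "open_kn_space point_space point_le (point_rel imp) point_nbhds" if "open_implication imp"
    using kn_space_points open_kn_frame_points[OF that] by (simp add: open_kn_space_def)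
  then show ?thesis
    using kn_space_points kn_embedding_stone by blast
qed

end
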